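(* For every integer $k\ge 0$, the $X_k$ subtree of $T_B(\infty)$ with root $(1,\dots,1)$ ($k$ ones; the empty partition $()$ if $k=0$) contains exactly the partitions of length $k$; that is, its node set is the set of all partitions with exactly $k$ parts.
   Context: A partition is a finite sequence of integers $a=(a_1,\dots,a_k)$ with $a_1\ge\dots\ge a_k>0$ (the empty partition $()$ is allowed); $k$ is its length; by convention $a_j=0$ for $j>k$. $a^{\downarrow_i}$ denotes the sequence obtained from $a$ by replacing $a_i$ by $a_i+1$. $T_B(\infty)$ is the edge-labeled rooted binary tree with root $()$ in which every node $a$ has a left son $a^{\downarrow_1}$ (edge labeled $1$), and in which a nonempty node $a$ has in addition a right son exactly when, with $p\ge 1$ denoting the number of parts of $a$ equal to $a_1$, one has $a_p-a_{p+1}=1$; the right son is then $a^{\downarrow_{p+1}}$ (edge labeled $p+1$). Its nodes are the partitions generated from the root in this way. For $k\ge 1$, an $X_k$ subtree is a subtree of $T_B(\infty)$ rooted at a node $a=(i,\dots,i,a_{k+1},\dots)$ whose first $k$ parts equal $i$ and with $a_{k+1}\le i-1$, and which is: the whole subtree of $T_B(\infty)$ rooted at $a$ if $a$ has only one son; and otherwise $a$ together with its left subtree (the whole subtree rooted at its left son, and the edge to it). An $X_0$ subtree is a single node. *)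

theory Defs
  imports Main
begin

definition is_partition :: "nat list \<Rightarrow> bool" where
  "is_partition a \<longleftrightarrow> sorted_wrt (\<ge>) a \<and> (\<forall>x\<in>set a. 0 < x)"

text \<open>Parts are indexed from 1 and are 0 beyond the length.\<close>

definition part :: "nat list \<Rightarrow> nat \<Rightarrow> nat" where
  "part a j = (if 1 \<le> j \<and> j \<le> length a then a ! (j - 1) else 0)"

text \<open>Because of the previous convention, \<open>incr a (length a + 1)\<close> appends a part equal to 1.\<close>

definition incr :: "nat list \<Rightarrow> nat \<Rightarrow> nat list" where
  "incr a i = map (\<lambda>j. if j = i then part a j + 1 else part a j) [1..<max i (length a) + 1]"

definition num_max_parts :: "nat list \<Rightarrow> nat" where
  "num_max_parts a = count_list a (part a 1)"

text \<open>\<open>son a l b\<close>: there is an edge labeled \<open>l\<close> from \<open>a\<close> to its son \<open>b\<close>.\<close>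

inductive son :: "nat list \<Rightarrow> nat \<Rightarrow> nat list \<Rightarrow> bool" where
  left: "son a 1 (incr a 1)"
| right: "a \<noteq> [] \<Longrightarrow> p = num_max_parts a \<Longrightarrow> int (part a p) - int (part a (p + 1)) = 1 \<Longrightarrow>
    son a (p + 1) (incr a (p + 1))"

inductive_set TB_nodes :: "nat list set" where
  root: "[] \<in> TB_nodes"
| son: "a \<in> TB_nodes \<Longrightarrow> son a l b \<Longrightarrow> b \<in> TB_nodes"

record ptree =
  tree_root :: "nat list"
  nodes :: "nat list set"
  edges :: "(nat list \<times> nat \<times> nat list) set"

definition TB :: ptree where
  "TB = \<lparr>tree_root = [], nodes = TB_nodes, edges = {(a, l, b). a \<in> TB_nodes \<and> son a l b}\<rparr>"

definition descendants :: "ptree \<Rightarrow> nat list \<Rightarrow> nat list set" where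
  "descendants T a = {b. (a, b) \<in> {(x, y). \<exists>l. (x, l, y) \<in> edges T}\<^sup>*}"

definition whole_subtree :: "ptree \<Rightarrow> nat list \<Rightarrow> ptree" where
  "whole_subtree T a =
     \<lparr>tree_root = a, nodes = descendants T a,
      edges = {(x, l, y). (x, l, y) \<in> edges T \<and> x \<in> descendants T a}\<rparr>"

definition node_with_left_subtree :: "ptree \<Rightarrow> nat list \<Rightarrow> ptree" where
  "node_with_left_subtree T a =
     \<lparr>tree_root = a,
      nodes = insert a (nodes (whole_subtree T (incr a 1))),
      edges = insert (a, 1, incr a 1) (edges (whole_subtree T (incr a 1)))\<rparr>"

text \<open>The nodes at which an \<open>X\<^sub>k\<close> subtree is rooted. The strict inequality on natural
  numbers expresses \<open>a\<^sub>k\<^sub>+\<^sub>1 \<le> i - 1\<close> over the integers, so it forces \<open>i \<ge> 1\<close>.\<close>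

definition X_root :: "nat \<Rightarrow> nat list \<Rightarrow> bool" where
  "X_root k a \<longleftrightarrow> a \<in> nodes TB \<and>
     (k \<ge> 1 \<longrightarrow> (\<exists>i. (\<forall>j\<in>{1..k}. part a j = i) \<and> part a (k + 1) < i))"

text \<open>Only meaningful if \<open>X_root k a\<close> holds.\<close>

definition X_subtree :: "nat \<Rightarrow> nat list \<Rightarrow> ptree" where
  "X_subtree k a =
     (if k = 0 then \<lparr>tree_root = a, nodes = {a}, edges = {}\<rparr>
      else if \<exists>!b. \<exists>l. (a, l, b) \<in> edges TB then whole_subtree TB a
      else node_with_left_subtree TB a)"

end

theory Submission
  imports Defs
begin

text \<open>Write a nonempty partition as \<open>m\<^sup>p c\<close> with all parts of \<open>c\<close> below \<open>m\<close>. Its left son is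
  \<open>(m+1) m\<^sup>p\<^sup>-\<^sup>1 c\<close>; its right son is \<open>m\<^sup>p\<^sup>+\<^sup>1 c'\<close> if \<open>c = (m-1) c'\<close>, and has one more part only if
  the partition is \<open>(1,\<dots>,1)\<close>. Since no son has largest part below that of its father, the left
  subtree of \<open>(1,\<dots>,1)\<close> never changes the length. Conversely, every partition other than
  \<open>(1,\<dots>,1)\<close> is a son of a partition of the same length and smaller sum: lower its last maximal
  part by one.\<close>

lemma length_incr: "length (incr a i) = max i (length a)"
  by (auto simp: incr_def)

lemma nth_incr:
  "j < max i (length a) \<Longrightarrow>
     incr a i ! j = (if j < length a then a ! j else 0) + (if Suc j = i then 1 else 0)"
  by (auto simp: incr_def part_def simp del: upt_Suc)

lemma incr_append_Cons: "incr (xs @ n # ys) (Suc (length xs)) = xs @ Suc n # ys"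
  by (rule nth_equalityI) (auto simp: length_incr nth_incr nth_append)

lemma incr_Suc_length: "incr xs (Suc (length xs)) = xs @ [1]"
  by (rule nth_equalityI) (auto simp: length_incr nth_incr nth_append)

lemma incr_Cons_1: "incr (n # ys) 1 = Suc n # ys"
  using incr_append_Cons[of "[]"] by simp

lemma is_partition_append:
  "is_partition (xs @ ys) \<longleftrightarrow>
     is_partition xs \<and> is_partition ys \<and> (\<forall>x\<in>set xs. \<forall>y\<in>set ys. y \<le> x)"
  by (auto simp: is_partition_def sorted_wrt_append)

lemma is_partition_Cons:
  "is_partition (x # xs) \<longleftrightarrow> 0 < x \<and> is_partition xs \<and> (\<forall>y\<in>set xs. y \<le> x)"
  by (auto simp: is_partition_def)

lemma is_partition_replicate: "is_partition (replicate p m) \<longleftrightarrow> p = 0 \<or> 0 < m"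
  by (induction p) (auto simp: is_partition_Cons, simp add: is_partition_def)

text \<open>\<open>Suc p\<close> keeps the block of largest parts nonempty. The rest
  \<open>c\<close> may be empty, in which case its bound says nothing about
  \<open>m\<close>.\<close>

lemma partition_decomp:
  assumes "is_partition a" "a \<noteq> []"
  obtains p m c where "a = replicate (Suc p) m @ c" "\<forall>x\<in>set c. x < m"
proof -
  have "\<exists>p m c. a = replicate (Suc p) m @ c \<and> (\<forall>x\<in>set c. x < m)"
    using assms
  proof (induction a)
    case (Cons x a)
    show ?case
    proof (cases "x \<in> set a")
      case True
      then have "a \<noteq> []"
        by auto
      moreover have "is_partition a"
        using Cons.prems(1) by (simp add: is_partition_Cons)
      ultimately obtain p m c where a: "a = replicate (Suc p) m @ c" "\<forall>x\<in>set c. x < m"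
        using Cons.IH by blast
      \<comment> \<open>\<open>x\<close> bounds every entry of \<open>a\<close> and occurs in it, so
        it is the largest part \<open>m\<close> and lengthens the first block.\<close>
      with True Cons.prems have "x = m"
        by (fastforce simp: is_partition_Cons)
      with a show ?thesis
        by (intro exI[of _ "Suc p"] exI[of _ m] exI[of _ c]) auto
    next
      case False
      with Cons.prems have "\<forall>y\<in>set a. y < x"
        by (metis is_partition_Cons le_neq_implies_less)
      then show ?thesis
        by (intro exI[of _ 0] exI[of _ x] exI[of _ a]) simp
    qed
  qed simp
  with that show thesis by blast
qed

context
  fixes m p :: nat and c :: "nat list"
  assumes c: "\<forall>x\<in>set c. x < m"
begin

lemma num_max_parts_decomp: "num_max_parts (replicate (Suc p) m @ c) = Suc p"
proof -
  have "count_list (replicate n m) m = n" for n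
    by (induction n) auto
  moreover have "count_list c m = 0"
    using c by (auto simp: count_list_0_iff)
  ultimately show ?thesis
    by (simp add: num_max_parts_def part_def)
qed

lemma part_decomp:
  "part (replicate (Suc p) m @ c) (Suc p) = m"
  "part (replicate (Suc p) m @ c) (Suc (Suc p)) = (case c of [] \<Rightarrow> 0 | n # _ \<Rightarrow> n)"
  by (auto simp: part_def nth_append nth_Cons' split: list.split)

text \<open>The right son raises the position just after the block of largest parts. If
  \<open>c\<close> is empty, the part there is 0 by convention, so a gap of one forces
  \<open>m = 1\<close> and a new part appears; otherwise the head of \<open>c\<close> rises to
  \<open>m\<close>. In the last disjunct the truncated \<open>m - 1\<close> is safe: it is an entry
  of \<open>c\<close>, hence below \<open>m\<close>.\<close>

lemma son_decomp_iff:
  "son (replicate (Suc p) m @ c) l b \<longleftrightarrow>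
     l = 1 \<and> b = Suc m # replicate p m @ c \<or>
     l = Suc (Suc p) \<and> c = [] \<and> m = 1 \<and> b = replicate (Suc (Suc p)) 1 \<or>
     l = Suc (Suc p) \<and> (\<exists>c'. c = (m - 1) # c' \<and> b = replicate (Suc (Suc p)) m @ c')"
proof -
  let ?a = "replicate (Suc p) m @ c"
  have left: "incr ?a 1 = Suc m # replicate p m @ c"
    by (simp add: incr_Cons_1[simplified])
  have rep: "replicate (Suc (Suc p)) x = replicate (Suc p) x @ [x]" for x :: nat
    by (metis replicate_Suc replicate_append_same)
  have right: "incr ?a (Suc (Suc p)) =
      (case c of [] \<Rightarrow> replicate (Suc p) m @ [1] | n # c' \<Rightarrow> replicate (Suc p) m @ Suc n # c')"
    using incr_Suc_length[of "replicate (Suc p) m"]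
      incr_append_Cons[of "replicate (Suc p) m"]
    by (auto split: list.split)
  have "son ?a l b \<longleftrightarrow> l = 1 \<and> b = incr ?a 1 \<or>
      l = Suc (Suc p) \<and> b = incr ?a (Suc (Suc p)) \<and>
      int m - int (case c of [] \<Rightarrow> 0 | n # _ \<Rightarrow> n) = 1"
    unfolding son.simps num_max_parts_decomp Suc_eq_plus1[symmetric]
    using part_decomp num_max_parts_decomp by (auto simp del: replicate_Suc)
  also have "\<dots> \<longleftrightarrow> l = 1 \<and> b = Suc m # replicate p m @ c \<or>
     l = Suc (Suc p) \<and> c = [] \<and> m = 1 \<and> b = replicate (Suc (Suc p)) 1 \<or>
     l = Suc (Suc p) \<and> (\<exists>c'. c = (m - 1) # c' \<and> b = replicate (Suc (Suc p)) m @ c')"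
    unfolding left right rep
    using c by (cases c) (auto simp del: replicate_Suc)
  finally show ?thesis .
qed

end

lemma son_ones_iff:
  "son (replicate (Suc p) 1) l b \<longleftrightarrow>
     l = 1 \<and> b = 2 # replicate p 1 \<or> l = Suc (Suc p) \<and> b = replicate (Suc (Suc p)) 1"
  using son_decomp_iff[of "[]" 1 p l b] by (simp add: numeral_2_eq_2)

lemma ones_in_TB_nodes: "replicate k 1 \<in> TB_nodes"
proof (induction k)
  case (Suc k)
  have "son (replicate k 1) (Suc k) (replicate (Suc k) 1)"
  \<comment> \<open>The empty partition has only a left son, which starts the chain; every later
    step takes a right son.\<close>
  proof (cases k)
    case 0
    then show ?thesis
      using son.left[of "[]"] incr_Suc_length[of "[]"] by simp
  qed (use son_ones_iff in blast)
  with Suc show ?case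
    by (rule TB_nodes.son)
qed (simp add: TB_nodes.root)

lemma son_preserves_length:
  assumes "son a l b" "is_partition a" "a \<noteq> []" "1 < hd a"
  shows "is_partition b \<and> length b = length a \<and> 1 < hd b"
proof -
  from assms(2,3) obtain p m c where a: "a = replicate (Suc p) m @ c" and c: "\<forall>x\<in>set c. x < m"
    by (rule partition_decomp)
  \<comment> \<open>Here \<open>m > 1\<close>, which excludes the only case that adds a part; in the
    other two the new head is \<open>Suc m\<close> or \<open>m\<close>.\<close>
  from assms(1) show ?thesis
    unfolding a son_decomp_iff[OF c] using assms(2,4) c
    by (fastforce simp: a is_partition_append is_partition_Cons is_partition_replicate)
qed

text \<open>A largest part above 1 stays positive when lowered, so the length survives. The drop in
  the sum drives the later induction.\<close>

lemma partition_father: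
  assumes "is_partition b" "b \<noteq> []" "1 < hd b"
  obtains a l where "son a l b" "is_partition a" "length a = length b" "sum_list a < sum_list b"
proof -
  from assms(1,2) obtain p m c where b: "b = replicate (Suc p) m @ c" and c: "\<forall>x\<in>set c. x < m"
    by (rule partition_decomp)
  from assms(3) b obtain n where m: "m = Suc n" "0 < n"
    by (cases m) auto
  show thesis
  proof (cases p)
    \<comment> \<open>A single largest part: lowering the head keeps the order, and \<open>b\<close>
      is the left son, whether or not \<open>n\<close> occurs in \<open>c\<close>.\<close>
    case 0
    have "is_partition (n # c)"
      using assms(1) c m by (auto simp: b is_partition_append is_partition_Cons)
    moreover have "son (n # c) 1 b"
      using son.left[of "n # c"] by (simp add: b m 0 incr_Cons_1[simplified])
    ultimately show thesis
      by (intro that[of "n # c" 1]) (simp_all add: b m 0)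
  next
    \<comment> \<open>At least two largest parts: the lowered last one now follows a block of
      \<open>Suc q\<close> copies of \<open>m\<close> with gap one, so \<open>b\<close> is the right
      son.\<close>
    case (Suc q)
    let ?a = "replicate (Suc q) m @ n # c"
    have "is_partition ?a"
      using assms(1) c m by (auto simp: b is_partition_append is_partition_Cons is_partition_replicate)
    moreover have "son ?a (Suc (Suc q)) b"
      using c m by (subst son_decomp_iff) (auto simp: b Suc)
    ultimately show thesis
      by (intro that[of ?a "Suc (Suc q)"]) (simp_all add: b m Suc sum_list_replicate)
  qed
qed

lemma partition_hd_le_1:
  assumes "is_partition a" "a = [] \<or> \<not> 1 < hd a"
  shows "a = replicate (length a) 1"
proof (rule replicate_eqI)
  fix x assume "x \<in> set a"
  with assms show "x = 1"
    by (cases a) (force simp: is_partition_Cons is_partition_def)+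
qed simp

text \<open>Edges of \<open>TB\<close> start only at its nodes, so node membership must first be
  carried along the path from \<open>r\<close>.\<close>

lemma descendants_TB_son:
  assumes "a \<in> descendants TB r" "r \<in> TB_nodes" "son a l b"
  shows "b \<in> descendants TB r"
proof -
  have "(r, a) \<in> {(x, y). \<exists>l. (x, l, y) \<in> edges TB}\<^sup>*"
    using assms(1) by (simp add: descendants_def)
  moreover from this assms(2) have "a \<in> TB_nodes"
    by (induction rule: rtrancl_induct) (auto simp: TB_def intro: TB_nodes.son)
  with assms(3) have "(a, b) \<in> {(x, y). \<exists>l. (x, l, y) \<in> edges TB}"
    by (auto simp: TB_def)
  ultimately show ?thesis
    unfolding descendants_def by (blast intro: rtrancl_into_rtrancl)
qed

lemma descendants_TB_closed:
  assumes "b \<in> descendants TB r" "P r" "\<And>a l b. P a \<Longrightarrow> son a l b \<Longrightarrow> P b"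
  shows "P b"
proof -
  have "(r, b) \<in> {(x, y). \<exists>l. (x, l, y) \<in> edges TB}\<^sup>*"
    using assms(1) by (simp add: descendants_def)
  then show ?thesis
    using assms(2) by (induction rule: rtrancl_induct) (auto simp: TB_def intro: assms(3))
qed

text \<open>One inclusion is an invariant of \<open>son\<close>. For the other, go from father to
  father; the sum falls, so the climb ends, and it can only end just below the all-ones
  partition.\<close>

lemma descendants_TB_left_son_ones:
  "descendants TB (2 # replicate p 1) = {a. is_partition a \<and> length a = Suc p \<and> 1 < hd a}"
proof (intro equalityI subsetI)
  fix b assume "b \<in> descendants TB (2 # replicate p 1)"
  then have "is_partition b \<and> length b = Suc p \<and> 1 < hd b"
  proof (rule descendants_TB_closed)
    show "is_partition (2 # replicate p 1) \<and> length (2 # replicate p (1 :: nat)) = Suc p \<and>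
        1 < hd (2 # replicate p (1 :: nat))"
      by (auto simp: is_partition_Cons is_partition_replicate)
  qed (metis son_preserves_length list.size(3) nat.distinct(1))
  then show "b \<in> {a. is_partition a \<and> length a = Suc p \<and> 1 < hd a}"
    by simp
next
  have root: "2 # replicate p 1 \<in> TB_nodes"
    using ones_in_TB_nodes son_ones_iff TB_nodes.son by blast
  fix b assume "b \<in> {a. is_partition a \<and> length a = Suc p \<and> 1 < hd a}"
  then show "b \<in> descendants TB (2 # replicate p 1)"
  proof (induction b rule: measure_induct_rule[of sum_list])
    case (less b)
    then have b: "is_partition b" "b \<noteq> []" "1 < hd b" and len: "length b = Suc p"
      by auto
    from b obtain a l where a: "son a l b" "is_partition a" "length a = length b"
        "sum_list a < sum_list b"
      by (rule partition_father)
    show ?case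
    proof (cases "1 < hd a")
      case True
      with a len less.IH[of a] root show ?thesis
        by (auto intro: descendants_TB_son)
    next
      case False
      with a len partition_hd_le_1[of a] have "son (replicate (Suc p) 1) l b"
        by simp
      \<comment> \<open>The right son of the all-ones partition has one part too many, so
        \<open>b\<close> is the left son.\<close>
      with len have "b = 2 # replicate p 1"
        unfolding son_ones_iff by auto
      then show ?thesis
        by (simp add: descendants_def)
    qed
  qed
qed

theorem corollary1:
  fixes k :: nat
  shows "X_root k (replicate k 1) \<and>
    nodes (X_subtree k (replicate k 1)) = {a. is_partition a \<and> length a = k}"
proof (cases k)
  case 0
  then show ?thesis
    by (auto simp: X_root_def X_subtree_def TB_def is_partition_def TB_nodes.root)
next
  case (Suc p)
  have "X_root k (replicate k 1)"
  proof -
    have "\<forall>j\<in>{1..k}. part (replicate k 1) j = 1" "part (replicate k 1) (k + 1) < 1"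
      by (auto simp: part_def)
    then show ?thesis
      using ones_in_TB_nodes[of k] unfolding X_root_def TB_def by (simp only: ptree.simps) blast
  qed
  moreover have "nodes (X_subtree k (replicate k 1)) = {a. is_partition a \<and> length a = k}"
  proof -
    have edge: "(replicate k 1, l, b) \<in> edges TB \<longleftrightarrow> son (replicate k 1) l b" for l b
      using ones_in_TB_nodes[of k] by (auto simp: TB_def)
    \<comment> \<open>The root has two distinct sons, which selects the branch of
      \<open>X_subtree\<close> with the left subtree only.\<close>
    have "2 # replicate p 1 \<noteq> replicate (Suc (Suc p)) (1 :: nat)"
      by simp
    then have "\<not> (\<exists>!b. \<exists>l. (replicate k 1, l, b) \<in> edges TB)"
      unfolding edge unfolding Suc son_ones_iff by blast
    moreover have "incr (replicate k 1) 1 = 2 # replicate p 1"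
      using incr_Cons_1[of 1 "replicate p 1"] by (simp add: Suc numeral_2_eq_2)
    ultimately have "nodes (X_subtree k (replicate k 1)) =
        insert (replicate k 1) (descendants TB (2 # replicate p 1))"
      by (simp only: X_subtree_def node_with_left_subtree_def whole_subtree_def Suc) simp
    \<comment> \<open>The only partition of length \<open>k\<close> without a part above 1 is the
      root itself, the inserted element.\<close>
    also have "\<dots> = {a. is_partition a \<and> length a = k}"
      unfolding descendants_TB_left_son_ones
      using partition_hd_le_1
      by (auto simp: Suc is_partition_replicate simp del: replicate_Suc) metis
    finally show ?thesis .
  qed
  ultimately show ?thesis ..
qed

end
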